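(* For all $\alpha,\beta$, with $A=\alpha^2$, $B=\beta^2$, as formal series in $Z^{-1}$, $$F(\alpha,\beta;Z)=\sum_{r\ge0}\frac{(-1)^r\,\gamma_r(A)\,\gamma_r(B)}{2^{r}\,r!\,(1-Z)_{2r}\,(-Z+r)_r}\;\mathcal P_r(A;Z)\;\overline{\mathcal P}_r(B;Z),$$ where $\gamma_r(A)=(\tfrac12-\alpha)_r(\tfrac12+\alpha)_r=\prod_{j=0}^{r-1}\bigl((j+\tfrac12)^2-A\bigr)$ (and likewise $\gamma_r(B)$ with $\beta$), $\mathcal P_r(A;Z)={}_2F_1(\tfrac12-\alpha+r,\tfrac12+\alpha+r;1-Z+2r;x_0)$, and $\overline{\mathcal P}_r(B;Z)={}_2F_1(\tfrac12-\beta+r,\tfrac12+\beta+r;1-Z+2r;y_0)$, with $x_0=\frac{1+i}2$, $y_0=\bar x_0=\frac{1-i}2$. Each layer is $O(Z^{-3r})$: with $v=1/Z$, $$\frac{(-1)^r\,(x_0y_0)^r}{r!\,(1-Z)_{2r}\,(-Z+r)_r}=\frac{v^{3r}}{2^{r}\,r!}\,\prod_{j=1}^{2r}\frac1{1-jv}\;\prod_{j=r}^{2r-1}\frac1{1-jv}.$$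
   Context: $(z)_k$ is the Pochhammer symbol. For $\nu\in\mathbb C$ and $k\ge0$ let $a_k(\nu)=\dfrac{(\frac12+\nu)_k(\frac12-\nu)_k}{(-2)^k k!}$. Let $p=1+i$, $q=1-i$. For $\alpha,\beta\in\mathbb C$ put $G_n=\sum_{l=0}^n a_l(\alpha)a_{n-l}(\beta)p^lq^{n-l}$ and $$F(\alpha,\beta;Z)=\sum_{n\ge0}\frac{G_n}{(Z-1)(Z-2)\cdots(Z-n)},$$ a formal power series in $Z^{-1}$ (each summand expanded at $Z=\infty$). The Gauss series ${}_2F_1(a,b;1-Z+2r;x)=\sum_k\frac{(a)_k(b)_k}{(1-Z+2r)_k\,k!}x^k$ are likewise read as formal power series in $Z^{-1}$: the $k$-th term is $O(Z^{-k})$ when $1/(1-Z+2r)_k$ is expanded at $Z=\infty$. Empty products equal $1$. *)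

theory Defs
  imports Complex_Main "HOL-Computational_Algebra.Formal_Laurent_Series"
begin

text \<open>
  All series live in the field of formal Laurent series in \<open>v = 1/Z\<close>, so that
  dividing by a polynomial in \<open>Z\<close> is the same as expanding at \<open>Z = \<infinity>\<close>.
  A series is \<open>O(Z\<^sup>-\<^sup>m)\<close> iff its coefficients at all integers below \<open>m\<close> vanish; in particular,
  it is a power series in \<open>1/Z\<close> iff its coefficients at all negative integers vanish.
  Infinite sums are taken with respect to the \<open>v\<close>-adic metric on \<^typ>\<open>complex fls\<close>.
\<close>

definition Z :: "complex fls" where "Z = inverse fls_X"

definition a_coeff :: "complex \<Rightarrow> nat \<Rightarrow> complex" where
  "a_coeff \<nu> k = pochhammer (1/2 + \<nu>) k * pochhammer (1/2 - \<nu>) k / ((-2) ^ k * fact k)"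

definition p_val :: complex where "p_val = 1 + \<i>"
definition q_val :: complex where "q_val = 1 - \<i>"

definition G_coeff :: "complex \<Rightarrow> complex \<Rightarrow> nat \<Rightarrow> complex" where
  "G_coeff \<alpha> \<beta> n = (\<Sum>l=0..n. a_coeff \<alpha> l * a_coeff \<beta> (n - l) * p_val ^ l * q_val ^ (n - l))"

definition F_series :: "complex \<Rightarrow> complex \<Rightarrow> complex fls" where
  "F_series \<alpha> \<beta> = (\<Sum>n. fls_const (G_coeff \<alpha> \<beta> n) / (\<Prod>j=1..n. Z - of_nat j))"

definition gauss_2F1 :: "complex \<Rightarrow> complex \<Rightarrow> complex fls \<Rightarrow> complex \<Rightarrow> complex fls" where
  "gauss_2F1 b c d x =
     (\<Sum>k. fls_const (pochhammer b k * pochhammer c k) / (pochhammer d k * fact k) * fls_const x ^ k)"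

definition x0 :: complex where "x0 = (1 + \<i>) / 2"
definition y0 :: complex where "y0 = cnj x0"

definition \<gamma> :: "nat \<Rightarrow> complex \<Rightarrow> complex" where
  "\<gamma> r A = (\<Prod>j<r. (of_nat j + 1/2)\<^sup>2 - A)"

text \<open>
  \<open>\<P> r \<alpha>\<close> and \<open>\<P>bar r \<beta>\<close> stand for the series \<open>\<P>\<^sub>r(A;Z)\<close> with \<open>A = \<alpha>\<^sup>2\<close> and its barred
  counterpart with \<open>B = \<beta>\<^sup>2\<close>; by symmetry of \<open>\<^sub>2F\<^sub>1\<close> in its upper parameters, they depend on
  \<open>\<alpha>\<^sup>2\<close> and \<open>\<beta>\<^sup>2\<close> only (lemma \<open>P_cong\<close>).
\<close>

definition \<P> :: "nat \<Rightarrow> complex \<Rightarrow> complex fls" where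
  "\<P> r \<alpha> = gauss_2F1 (1/2 - \<alpha> + of_nat r) (1/2 + \<alpha> + of_nat r) (1 - Z + 2 * of_nat r) x0"

definition \<P>bar :: "nat \<Rightarrow> complex \<Rightarrow> complex fls" where
  "\<P>bar r \<beta> = gauss_2F1 (1/2 - \<beta> + of_nat r) (1/2 + \<beta> + of_nat r) (1 - Z + 2 * of_nat r) y0"

lemma P_cong:
  assumes "\<alpha>\<^sup>2 = \<alpha>'\<^sup>2"
  shows "\<P> r \<alpha> = \<P> r \<alpha>'" "\<P>bar r \<alpha> = \<P>bar r \<alpha>'"
  using assms by (auto simp: power2_eq_iff \<P>_def \<P>bar_def gauss_2F1_def mult.commute)

subsection \<open>The defining series converge\<close>

lemma summable_fls:
  fixes f :: "nat \<Rightarrow> complex fls"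
  assumes f: "\<And>n k. k < int n \<Longrightarrow> fls_nth (f n) k = 0"
  shows "summable f"
proof -
  define S where "S = fps_to_fls (Abs_fps (\<lambda>m. \<Sum>n\<le>m. fls_nth (f n) (int m)))"
  have nth_sum: "fls_nth (sum f {..<N}) k = (\<Sum>n<N. fls_nth (f n) k)" for N k
    by (induction N) auto
  have eq: "fls_nth (sum f {..<N}) k = fls_nth S k" if "k < int N" for N k
  proof (cases "k < 0")
    case True
    thus ?thesis by (simp add: nth_sum S_def f)
  next
    case False
    hence "(\<Sum>n<N. fls_nth (f n) k) = (\<Sum>n\<le>nat k. fls_nth (f n) k)"
      using that by (intro sum.mono_neutral_right) (force intro: f)+
    thus ?thesis using False by (simp add: nth_sum S_def)
  qed
  have dist: "dist (sum f {..<N}) S \<le> (1/2) ^ N" for N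
  proof (cases "sum f {..<N} = S")
    case False
    hence "int N \<le> fls_subdegree (sum f {..<N} - S)"
      using eq by (intro fls_subdegree_geI) auto
    hence "(2::real) ^ N \<le> 2 ^ nat (fls_subdegree (sum f {..<N} - S))"
      by (intro power_increasing) auto
    with False \<open>int N \<le> _\<close> show ?thesis
      by (auto simp: dist_fls_def field_simps power_divide)
  qed auto
  have *: "(\<lambda>N. (1/2) ^ N :: real) \<longlonglongrightarrow> 0"
    by (intro LIMSEQ_power_zero) auto
  have "(\<lambda>N. dist (sum f {..<N}) S) \<longlonglongrightarrow> 0"
    by (rule tendsto_sandwich[OF _ _ tendsto_const *]) (simp_all add: dist)
  hence "f sums S"
    unfolding sums_def by (subst tendsto_dist_iff)
  thus ?thesis by (rule sums_summable)
qed

lemma subdegree_linear [simp]: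
  assumes "fls_subdegree c \<ge> 0"
  shows "fls_subdegree (Z - c) = -1" "fls_subdegree (c - Z) = -1"
proof -
  have Z: "fls_nth Z k = (if k = -1 then 1 else 0)" for k
    by (simp add: Z_def fls_inverse_X)
  have c: "fls_nth c k = 0" if "k < 0" for k
    using assms that by (intro fls_eq0_below_subdegree) auto
  show "fls_subdegree (Z - c) = -1"
    by (intro fls_subdegree_eqI) (auto simp: Z c)
  thus "fls_subdegree (c - Z) = -1"
    by (metis fls_subdegree_minus_sym)
qed

lemma summable_F:
  "summable (\<lambda>n. fls_const (G_coeff \<alpha> \<beta> n) / (\<Prod>j=1..n. Z - of_nat j))"
proof (rule summable_fls)
  fix n k assume "k < int n"
  have nz: "Z - of_nat j \<noteq> 0" for j
    using subdegree_linear(1)[of "of_nat j"] by (auto simp: fls_of_nat simp del: subdegree_linear)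
  have "fls_subdegree (\<Prod>j=1..n. Z - of_nat j) = - int n"
    using nz by (subst fls_subdegree_prod) (auto simp: fls_of_nat)
  thus "fls_nth (fls_const (G_coeff \<alpha> \<beta> n) / (\<Prod>j=1..n. Z - of_nat j)) k = 0"
    using \<open>k < int n\<close> nz
    by (cases "G_coeff \<alpha> \<beta> n = 0") (auto intro!: fls_eq0_below_subdegree simp: fls_divide_subdegree)
qed

lemma summable_gauss_2F1:
  "summable (\<lambda>k. fls_const (pochhammer b k * pochhammer c k) /
      (pochhammer (1 - Z + 2 * of_nat r) k * fact k) * fls_const x ^ k)"
proof (rule summable_fls)
  fix k m assume m: "m < int k"
  have eq: "1 - Z + 2 * of_nat r + of_nat i = of_nat (1 + 2 * r + i) - Z" for i
    by simp
  have sd: "fls_subdegree (1 - Z + 2 * of_nat r + of_nat i) = -1" for i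
    unfolding eq by (rule subdegree_linear) (simp add: fls_of_nat)
  have nz: "1 - Z + 2 * of_nat r + of_nat i \<noteq> 0" for i
    using sd[of i] by auto
  define P where "P = pochhammer (1 - Z + 2 * of_nat r) k"
  have P: "P \<noteq> 0" "fls_subdegree P = - int k"
    using nz by (auto simp: P_def pochhammer_prod sd fls_subdegree_prod)
  have fct: "(fact k :: complex fls) = fls_const (fact k)"
    by (metis fls_of_nat of_nat_fact)
  define c' where "c' = pochhammer b k * pochhammer c k / fact k * x ^ k"
  have c': "fls_const c' = fls_const (pochhammer b k * pochhammer c k) / fact k * fls_const x ^ k"
    unfolding c'_def fct by (simp only: fls_const_divide_const fls_const_mult_const flip: fls_const_power)
  have "fls_const (pochhammer b k * pochhammer c k) / (P * fact k) * fls_const x ^ k = fls_const c' / P"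
    unfolding c' by (simp only: divide_inverse inverse_mult_distrib mult_ac)
  moreover have "fls_nth (fls_const c' / P) m = 0"
    using m P by (cases "c' = 0") (auto intro!: fls_eq0_below_subdegree simp: fls_divide_subdegree)
  ultimately show "fls_nth (fls_const (pochhammer b k * pochhammer c k) /
      (pochhammer (1 - Z + 2 * of_nat r) k * fact k) * fls_const x ^ k) m = 0"
    by (simp add: P_def)
qed

end

theory Submission
  imports Defs
begin

text \<open>
  Because \<open>(Z - 1)\<cdots>(Z - n) = (-1)\<^sup>n (1 - Z)\<^sub>n\<close>, \<open>p = 2x\<^sub>0\<close> and \<open>q = 2y\<^sub>0\<close>, the series \<open>F(\<alpha>, \<beta>; Z)\<close> is the
  third Appell function
  \<open>F\<^sub>3(1/2 - \<alpha>, 1/2 - \<beta>, 1/2 + \<alpha>, 1/2 + \<beta>; 1 - Z; x\<^sub>0, y\<^sub>0)\<close>, and the claimed expansion is the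
  classical one by Burchnall and Chaundy (theorem \<open>Burchnall_Chaundy_F3\<close>),
  \[ F_3(a,a',b,b';c;x,y) = \sum_r \frac{(-1)^r (a)_r (a')_r (b)_r (b')_r}{r!\,(c+r-1)_r\,(c)_{2r}} x^r y^r
     {}_2F_1(a+r,b+r;c+2r;x)\,{}_2F_1(a'+r,b'+r;c+2r;y), \]
  with \<open>x\<^sub>0 y\<^sub>0 = 1/2\<close>.

  The expansion holds coefficientwise in \<open>x\<close> and \<open>y\<close>. As \<open>(a)\<^sub>r (a + r)\<^bsub>l-r\<^esub> = (a)\<^sub>l\<close>, the upper
  parameters cancel from the comparison of the coefficients at \<open>x\<^sup>l y\<^sup>m\<close>, and what remains
  is a terminating identity in \<open>c\<close>, lemma \<open>F3_coefficient_identity\<close>. It is a case of the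
  summation of the very-well-poised \<open>\<^sub>4F\<^sub>3(-1)\<close>, which is proved here by induction on \<open>m\<close>
  with a telescoping certificate.

  Rearranging the infinite sums is legitimate in the \<open>v\<close>-adic topology, \<open>v = 1/Z\<close>: the weight
  of layer \<open>r\<close> is \<open>O(v\<^sup>3\<^sup>r)\<close> and the \<open>k\<close>-th term of a Gauss series is \<open>O(v\<^sup>k)\<close>, so modulo any power of \<open>v\<close>
  only finitely many terms count and the rearrangement is one of finite sums
  (lemma \<open>sums_multiplied_out\<close>).
\<close>

section \<open>A very-well-poised summation\<close>

text \<open>
  With \<open>b = -l\<close> and \<open>c = -m\<close> this is, up to the factor \<open>1 / ((a+1)\<^sub>l (a+1)\<^sub>m)\<close>, the general term of
  the very-well-poised series
  \<open>\<^sub>4F\<^sub>3(a, 1 + a/2, b, c; a/2, 1 + a - b, 1 + a - c; -1)\<close>.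
\<close>

definition well_poised_term :: "'a::field_char_0 \<Rightarrow> nat \<Rightarrow> nat \<Rightarrow> nat \<Rightarrow> 'a" where
  "well_poised_term a l m r = (-1) ^ r * pochhammer (- of_nat l) r * pochhammer (- of_nat m) r
     * (a + 2 * of_nat r) * pochhammer a r
     / (a * fact r * pochhammer (a + 1) (l + r) * pochhammer (a + 1) (m + r))"

text \<open>
  With \<open>U(l,m,r)\<close> for the general term above, the claim \<open>\<Sum>\<^sub>r U(l,m,r) = 1 / (a+1)\<^bsub>l+m\<^esub>\<close> amounts to
  \<open>(a+1+l+m) \<Sum>\<^sub>r U(l,m+1,r) = \<Sum>\<^sub>r U(l,m,r)\<close>, and the difference of the two summands telescopes
  (Gosper summation). The right-hand side below is the antidifference. It contains \<open>(-m)\<^sub>k\<close>, so it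
  vanishes once \<open>k\<close> exceeds \<open>m\<close>.
\<close>

lemma well_poised_partial_sum:
  fixes a :: "'a::field_char_0"
  assumes nz: "\<And>n. a + of_nat n \<noteq> 0"
  shows "(\<Sum>r\<le>k. (a + 1 + of_nat l + of_nat m) * well_poised_term a l (Suc m) r - well_poised_term a l m r)
    = (-1) ^ Suc k * pochhammer (- of_nat l) (Suc k) * pochhammer (- of_nat m) k * pochhammer a (Suc k)
      / (a * fact k * pochhammer (a + 1) (l + k) * pochhammer (a + 1) (Suc (m + k)))"
    (is "_ = ?H k")
proof (induction k)
  case 0
  have a: "a \<noteq> 0" using nz[of 0] by simp
  have p: "pochhammer (a + 1) n \<noteq> 0" for n
    using nz[of "Suc _"] by (auto simp: pochhammer_eq_0_iff eq_neg_iff_add_eq_0 add_ac)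
  have "a + 1 + of_nat m \<noteq> 0" using nz[of "Suc m"] by (simp add: add_ac)
  thus ?case using a p by (simp add: well_poised_term_def pochhammer_Suc divide_simps; simp add: algebra_simps)
next
  case (Suc k)
  have a: "a \<noteq> 0" using nz[of 0] by simp
  have p: "pochhammer (a + 1) n \<noteq> 0" for n
    using nz[of "Suc _"] by (auto simp: pochhammer_eq_0_iff eq_neg_iff_add_eq_0 add_ac)
  have k: "of_nat k + (1::'a) \<noteq> 0" by (metis of_nat_Suc of_nat_neq_0 add.commute)
  have s1: "a + 1 + of_nat l + of_nat k \<noteq> 0" using nz[of "Suc (l + k)"] by (simp add: add_ac)
  have s2: "a + 2 + of_nat m + of_nat k \<noteq> 0" using nz[of "Suc (Suc (m + k))"] by (simp add: add_ac)
  \<comment> \<open>The common factor of the two antidifferences and the two summands at \<open>k + 1\<close>; what is left after cancelling it is a polynomial identity.\<close>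
  define X where "X = (-1) ^ k * pochhammer (- of_nat l) (Suc k) * pochhammer (- of_nat m) k * pochhammer a (Suc k)
      / (a * fact (Suc k) * pochhammer (a + 1) (Suc (l + k)) * pochhammer (a + 1) (Suc (Suc (m + k))))"
  have H0: "?H k = - X * (of_nat k + 1) * (a + 1 + of_nat l + of_nat k) * (a + 2 + of_nat m + of_nat k)"
    using a p[of "l+k"] p[of "Suc (m+k)"] k s1 s2 unfolding X_def pochhammer_Suc[of "a+1" "l+k"] pochhammer_Suc[of "a+1" "Suc (m+k)"]
    by (simp add: divide_simps; simp add: algebra_simps)
  have H1: "?H (Suc k) = X * (of_nat k + 1 - of_nat l) * (of_nat k - of_nat m) * (a + of_nat k + 1)"
    unfolding X_def pochhammer_Suc[of "- of_nat l" "Suc k"] pochhammer_Suc[of "- of_nat m" k] pochhammer_Suc[of a "Suc k"]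
    by (simp add: algebra_simps)
  have U0: "well_poised_term a l m (Suc k) = - X * (of_nat k - of_nat m) * (a + 2 * of_nat k + 2) * (a + 2 + of_nat m + of_nat k)"
    using a p[of "Suc (l+k)"] p[of "Suc (m+k)"] k s1 s2 unfolding X_def well_poised_term_def pochhammer_Suc[of "- of_nat m" k] pochhammer_Suc[of "a+1" "Suc (m+k)"]
    by (simp add: divide_simps; simp add: algebra_simps)
  have U1: "well_poised_term a l (Suc m) (Suc k) = X * (of_nat m + 1) * (a + 2 * of_nat k + 2)"
    unfolding X_def well_poised_term_def pochhammer_rec[of "- of_nat (Suc m)" k]
    by (simp add: algebra_simps)
  show ?case
    unfolding sum.atMost_Suc Suc.IH H0 H1 U0 U1 by (simp add: algebra_simps)
qed

lemma sum_well_poised_term: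
  fixes a :: "'a::field_char_0"
  assumes nz: "\<And>n. a + of_nat n \<noteq> 0"
  shows "(\<Sum>r\<le>m. well_poised_term a l m r) = 1 / pochhammer (a + 1) (l + m)"
proof (induction m)
  case 0
  have "a \<noteq> 0" using nz[of 0] by simp
  thus ?case by (simp add: well_poised_term_def)
next
  case (Suc m)
  have s: "a + 1 + of_nat l + of_nat m \<noteq> 0" using nz[of "Suc (l + m)"] by (simp add: add_ac)
  have "(a + 1 + of_nat l + of_nat m) * (\<Sum>r\<le>Suc m. well_poised_term a l (Suc m) r) - (\<Sum>r\<le>Suc m. well_poised_term a l m r) = 0"
    using well_poised_partial_sum[OF nz, of l m "Suc m"]
    by (simp add: sum_subtractf sum_distrib_left pochhammer_of_nat_eq_0_iff del: sum.atMost_Suc pochhammer_Suc)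
  moreover have "(\<Sum>r\<le>Suc m. well_poised_term a l m r) = (\<Sum>r\<le>m. well_poised_term a l m r)"
    by (simp add: well_poised_term_def pochhammer_of_nat_eq_0_iff del: pochhammer_Suc)
  ultimately have "(a + 1 + of_nat l + of_nat m) * (\<Sum>r\<le>Suc m. well_poised_term a l (Suc m) r) = 1 / pochhammer (a + 1) (l + m)"
    using Suc.IH by simp
  hence "(\<Sum>r\<le>Suc m. well_poised_term a l (Suc m) r) = 1 / pochhammer (a + 1) (l + m) / (a + 1 + of_nat l + of_nat m)"
    using s by (subst nonzero_eq_divide_eq) (simp_all only: mult.commute not_False_eq_True)
  thus ?case by (simp add: pochhammer_Suc add_ac del: sum.atMost_Suc)
qed

lemma pochhammer_neg_nat:
  assumes "r \<le> l"
  shows "pochhammer (- of_nat l) r = ((-1) ^ r * fact l / fact (l - r) :: 'a::field_char_0)"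
proof -
  have "(of_nat (l choose r) :: 'a) = (-1) ^ r * pochhammer (- of_nat l) r / fact r"
    by (simp add: binomial_gbinomial gbinomial_pochhammer)
  also have "of_nat (l choose r) = (fact l / (fact r * fact (l - r)) :: 'a)"
    by (rule binomial_fact[OF assms])
  finally have "(-1) ^ r * ((-1) ^ r * pochhammer (- of_nat l) r) = ((-1) ^ r * (fact l / fact (l - r)) :: 'a)"
    by (simp add: field_simps)
  thus ?thesis by (simp flip: mult.assoc power_mult_distrib)
qed

text \<open>
  The coefficient identity behind the Burchnall--Chaundy expansion, with \<open>a + 1\<close> as the lower
  parameter: it says that both sides of the expansion have the same coefficient at \<open>x\<^sup>l y\<^sup>m\<close>.
  Since \<open>a (a+1)\<^bsub>2r\<^esub> = (a + 2r) (a)\<^sub>r (a + r)\<^sub>r\<close>, the summand is \<open>U(l,m,r) / (l! m!)\<close>, so the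
  very-well-poised summation applies.
\<close>

lemma F3_coefficient_identity:
  fixes a :: "'a::field_char_0"
  assumes nz: "\<And>n. a + of_nat n \<noteq> 0"
  shows "(\<Sum>r\<le>min l m. (-1) ^ r / (fact r * pochhammer (a + 1) (2 * r) * pochhammer (a + of_nat r) r)
           * (1 / (fact (l - r) * pochhammer (a + 1 + 2 * of_nat r) (l - r)))
           * (1 / (fact (m - r) * pochhammer (a + 1 + 2 * of_nat r) (m - r))))
         = 1 / (fact l * fact m * pochhammer (a + 1) (l + m))" (is "(\<Sum>r\<le>_. ?t r) = _")
proof -
  have a: "a \<noteq> 0" using nz[of 0] by simp
  have p: "pochhammer (a + of_nat k) n \<noteq> 0" for k n
    using nz[of "k + _"] by (auto simp: pochhammer_eq_0_iff eq_neg_iff_add_eq_0 add_ac)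
  have p1: "pochhammer (a + 1) n \<noteq> 0" for n using p[of 1] by simp
  have t: "?t r = well_poised_term a l m r / (fact l * fact m)" if r: "r \<le> min l m" for r
  proof -
    have 1: "a * pochhammer (a + 1) (2 * r) = (a + 2 * of_nat r) * pochhammer a r * pochhammer (a + of_nat r) r"
      using pochhammer_rec[of a "2*r"] pochhammer_Suc[of a "2*r"] pochhammer_product'[of a r r]
      by (simp add: mult_ac flip: mult_2)
    have 2: "pochhammer (a + 1) (n + r) = pochhammer (a + 1) (2 * r) * pochhammer (a + 1 + 2 * of_nat r) (n - r)"
      if "r \<le> n" for n
    proof -
      have "n + r = 2 * r + (n - r)" using that by simp
      thus ?thesis by (simp only: pochhammer_product' of_nat_mult of_nat_numeral)
    qed
    have l: "r \<le> l" and m: "r \<le> m" using r by auto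
    have q: "pochhammer (a + 1 + 2 * of_nat r) n \<noteq> 0" for n
      using p[of "Suc (2*r)" n] by (simp add: add_ac)
    have e: "(a + 2 * of_nat r) * pochhammer a r / a = pochhammer (a + 1) (2 * r) / pochhammer (a + of_nat r) r"
      using 1 a p[of r r] by (simp add: field_simps)
    have "well_poised_term a l m r = (-1) ^ r * pochhammer (- of_nat l) r * pochhammer (- of_nat m) r
      * ((a + 2 * of_nat r) * pochhammer a r / a)
      / (fact r * pochhammer (a + 1) (l + r) * pochhammer (a + 1) (m + r))"
      by (simp add: well_poised_term_def mult.assoc)
    also have "\<dots> = fact l * fact m * ?t r"
      unfolding e pochhammer_neg_nat[OF l] pochhammer_neg_nat[OF m] 2[OF l] 2[OF m]
      using p1[of "2*r"] p[of r r] q by (simp add: field_simps)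
    finally show ?thesis by simp
  qed
  have "(\<Sum>r\<le>min l m. ?t r) = (\<Sum>r\<le>min l m. well_poised_term a l m r) / (fact l * fact m)"
    unfolding sum_divide_distrib by (intro sum.cong refl t) simp
  also have "(\<Sum>r\<le>min l m. well_poised_term a l m r) = (\<Sum>r\<le>m. well_poised_term a l m r)"
    by (rule sum.mono_neutral_left) (auto simp: well_poised_term_def pochhammer_of_nat_eq_0_iff)
  finally show ?thesis by (simp add: sum_well_poised_term[OF nz])
qed

section \<open>Orders and infinite sums of Laurent series\<close>

text \<open>
  The relation \<open>f = O(v\<^sup>n)\<close> for Laurent series in \<open>v\<close>; unlike a bound on the subdegree, it also covers
  \<open>f = 0\<close>.
\<close>

definition ord_ge :: "'a::zero fls \<Rightarrow> nat \<Rightarrow> bool" where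
  "ord_ge f n \<longleftrightarrow> (\<forall>k < int n. fls_nth f k = 0)"

lemma ord_ge_subdegree: "ord_ge f n \<longleftrightarrow> f = 0 \<or> int n \<le> fls_subdegree f"
proof
  assume "ord_ge f n"
  thus "f = 0 \<or> int n \<le> fls_subdegree f"
    unfolding ord_ge_def using fls_subdegree_geI[of f "int n"] by blast
next
  assume "f = 0 \<or> int n \<le> fls_subdegree f"
  thus "ord_ge f n"
    unfolding ord_ge_def using fls_eq0_below_subdegree[of _ f] by (metis fls_zero_nth order_less_le_trans)
qed

lemma ord_ge_mono: "ord_ge f n \<Longrightarrow> m \<le> n \<Longrightarrow> ord_ge f m"
  by (auto simp: ord_ge_def)

lemma ord_ge_add: "ord_ge f n \<Longrightarrow> ord_ge g n \<Longrightarrow> ord_ge (f + g) n"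
  for f :: "'a::monoid_add fls"
  by (auto simp: ord_ge_def)

lemma ord_ge_diff: "ord_ge f n \<Longrightarrow> ord_ge g n \<Longrightarrow> ord_ge (f - g) n"
  for f :: "'a::group_add fls"
  by (auto simp: ord_ge_def)

lemma ord_ge_sum: "(\<And>i. i \<in> I \<Longrightarrow> ord_ge (f i) n) \<Longrightarrow> ord_ge (sum f I) n"
  for f :: "'b \<Rightarrow> 'a::comm_monoid_add fls"
  by (induction I rule: infinite_finite_induct) (simp_all add: ord_ge_add, simp_all add: ord_ge_def)

lemma ord_ge_mult: "ord_ge f m \<Longrightarrow> ord_ge g n \<Longrightarrow> ord_ge (f * g) (m + n)"
  for f :: "'a::idom fls"
  by (cases "f = 0 \<or> g = 0") (auto simp: ord_ge_subdegree)

lemma ord_ge_mult_integral: "ord_ge f n \<Longrightarrow> ord_ge g 0 \<Longrightarrow> ord_ge (f * g) n"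
  for f :: "'a::idom fls"
  using ord_ge_mult[of f n g 0] by simp

text \<open>
  Convergence in the \<open>v\<close>-adic metric is stabilisation of coefficients. When the \<open>n\<close>-th term is
  \<open>O(v\<^sup>n)\<close>, the partial sum of length \<open>N\<close> has already reached its final value modulo \<open>v\<^sup>N\<close>; this
  turns every statement about infinite sums below into one about finite sums.
\<close>

lemma sums_fls_iff:
  fixes f :: "nat \<Rightarrow> 'a::ab_group_add fls"
  assumes f: "\<And>n. ord_ge (f n) n"
  shows "f sums S \<longleftrightarrow> (\<forall>N. ord_ge (sum f {..<N} - S) N)"
proof
  assume S: "f sums S"
  show "\<forall>N. ord_ge (sum f {..<N} - S) N"
  proof
    fix N
    have "(\<lambda>M. dist (sum f {..<M}) S) \<longlonglongrightarrow> 0"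
      using S unfolding sums_def by (subst (asm) tendsto_dist_iff)
    moreover have "(0::real) < (1/2) ^ N" by simp
    ultimately have "\<forall>\<^sub>F M in sequentially. dist (sum f {..<M}) S < (1/2) ^ N"
      by (rule order_tendstoD)
    then obtain M\<^sub>0 where M\<^sub>0: "\<And>M. M \<ge> M\<^sub>0 \<Longrightarrow> dist (sum f {..<M}) S < (1/2) ^ N"
      unfolding eventually_sequentially by blast
    \<comment> \<open>A partial sum at least as long as \<open>N\<close> that agrees with \<open>S\<close> modulo \<open>v\<^sup>N\<close>; the terms between \<open>N\<close> and \<open>M\<close> do not matter modulo \<open>v\<^sup>N\<close>.\<close>
    define M where "M = max M\<^sub>0 N"
    have M: "M \<ge> N" "dist (sum f {..<M}) S < (1/2) ^ N"
      unfolding M_def by (auto intro!: M\<^sub>0)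
    have "ord_ge (sum f {..<M} - S) N"
    proof (cases "sum f {..<M} = S")
      case False
      show ?thesis
      proof (rule ccontr)
        assume "\<not> ?thesis"
        hence "fls_subdegree (sum f {..<M} - S) < int N" using False by (auto simp: ord_ge_subdegree)
        hence "nat (fls_subdegree (sum f {..<M} - S)) \<le> N" by simp
        hence "(2::real) ^ nat (fls_subdegree (sum f {..<M} - S)) \<le> 2 ^ N"
          by (rule power_increasing) simp
        hence "inverse ((2::real) ^ N) \<le> inverse (2 ^ nat (fls_subdegree (sum f {..<M} - S)))"
          by (intro le_imp_inverse_le) auto
        moreover have "inverse (2 ^ nat (fls_subdegree (sum f {..<M} - S))) \<le> dist (sum f {..<M}) S"
          using False by (auto simp: dist_fls_def)
        ultimately show False using M(2) by (simp add: power_one_over inverse_eq_divide)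
      qed
    qed (simp add: ord_ge_def)
    moreover have "sum f {..<M} = sum f {..<N} + sum f {N..<M}"
      using M(1) by (simp add: lessThan_atLeast0 sum.atLeastLessThan_concat)
    moreover have "ord_ge (sum f {N..<M}) N"
      by (rule ord_ge_sum) (auto intro: ord_ge_mono[OF f])
    ultimately show "ord_ge (sum f {..<N} - S) N"
      using ord_ge_diff[of "sum f {..<M} - S" N "sum f {N..<M}"] by (simp add: algebra_simps)
  qed
next
  assume S: "\<forall>N. ord_ge (sum f {..<N} - S) N"
  have dist: "dist (sum f {..<N}) S \<le> (1/2) ^ N" for N
  proof (cases "sum f {..<N} = S")
    case False
    hence N: "int N \<le> fls_subdegree (sum f {..<N} - S)"
      using S by (auto simp: ord_ge_subdegree)
    hence "(2::real) ^ N \<le> 2 ^ nat (fls_subdegree (sum f {..<N} - S))"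
      by (intro power_increasing) auto
    with False N show ?thesis
      by (auto simp: dist_fls_def field_simps)
  qed auto
  have *: "(\<lambda>N. (1/2) ^ N :: real) \<longlonglongrightarrow> 0"
    by (intro LIMSEQ_power_zero) auto
  have "(\<lambda>N. dist (sum f {..<N}) S) \<longlonglongrightarrow> 0"
    by (rule tendsto_sandwich[OF _ _ tendsto_const *]) (simp_all add: dist)
  thus "f sums S"
    unfolding sums_def by (subst tendsto_dist_iff)
qed

lemma ord_ge_suminf_tail:
  fixes f :: "nat \<Rightarrow> complex fls"
  assumes f: "\<And>n. ord_ge (f n) n"
  shows "ord_ge (suminf f - sum f {..<N}) N"
proof -
  have "summable f" using f by (intro summable_fls) (auto simp: ord_ge_def)
  hence "ord_ge (sum f {..<N} - suminf f) N"
    using sums_fls_iff[OF f] by (auto simp: summable_sums)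
  thus ?thesis using ord_ge_diff[of 0 N "sum f {..<N} - suminf f"] by (simp add: ord_ge_def)
qed

lemma ord_ge_suminf:
  fixes f :: "nat \<Rightarrow> complex fls"
  assumes f: "\<And>n. ord_ge (f n) n"
  shows "ord_ge (suminf f) 0"
  using ord_ge_suminf_tail[OF f, of 0] by simp

text \<open>
  Multiplying out the layers and collecting the terms with \<open>r + i = l\<close> and \<open>r + j = m\<close>. The weight
  is required to be \<open>O(v\<^sup>2\<^sup>r)\<close> because then \<open>w\<^sub>r p\<^sub>r\<^sub>,\<^sub>l\<^sub>-\<^sub>r q\<^sub>r\<^sub>,\<^sub>m\<^sub>-\<^sub>r\<close> is \<open>O(v\<^sup>l\<^sup>+\<^sup>m)\<close>, so that the collected series
  converges and only the pairs with \<open>l + m < N\<close> matter modulo \<open>v\<^sup>N\<close>.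
\<close>

lemma sums_multiplied_out:
  fixes w :: "nat \<Rightarrow> complex fls" and p q :: "nat \<Rightarrow> nat \<Rightarrow> complex fls"
  assumes w: "\<And>r. ord_ge (w r) (2 * r)"
    and p: "\<And>r i. ord_ge (p r i) i" and q: "\<And>r j. ord_ge (q r j) j"
  defines "T \<equiv> \<lambda>l m. \<Sum>r\<le>min l m. w r * p r (l - r) * q r (m - r)"
  shows "(\<lambda>r. w r * suminf (p r) * suminf (q r)) sums (\<Sum>n. \<Sum>l\<le>n. T l (n - l))"
proof -
  define S where "S = (\<Sum>n. \<Sum>l\<le>n. T l (n - l))"
  have T: "ord_ge (T l m) (l + m)" for l m
    unfolding T_def
  proof (rule ord_ge_sum)
    fix r assume "r \<in> {..min l m}"
    hence "2 * r + (l - r) + (m - r) = l + m" by auto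
    thus "ord_ge (w r * p r (l - r) * q r (m - r)) (l + m)"
      using ord_ge_mult[OF ord_ge_mult[OF w p] q, of r r "l - r" r "m - r"] by simp
  qed
  have Tn: "ord_ge (\<Sum>l\<le>n. T l (n - l)) n" for n
    by (rule ord_ge_sum) (rule ord_ge_mono[OF T], simp)
  have P: "ord_ge (suminf (p r)) 0" and Q: "ord_ge (suminf (q r)) 0" for r
    using p q by (auto intro: ord_ge_suminf)
  have layer: "ord_ge (w r * suminf (p r) * suminf (q r)) r" for r
    using ord_ge_mult[OF ord_ge_mult[OF w P] Q, of r r r] by (auto elim: ord_ge_mono)
  have "ord_ge ((\<Sum>r<N. w r * suminf (p r) * suminf (q r)) - S) N" for N
  proof -
    \<comment> \<open>With the inner series cut at \<open>N - r\<close>, the range of \<open>(l, m)\<close> becomes the square \<open>{r..<N}\<^sup>2\<close>; the tails are harmless modulo \<open>v\<^sup>N\<close>, since the weight makes up for the \<open>r\<close> missing orders.\<close>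
    define p' where "p' r = (\<Sum>i<N - r. p r i)" for r
    define q' where "q' r = (\<Sum>j<N - r. q r j)" for r
    have 1: "ord_ge (\<Sum>r<N. w r * suminf (p r) * suminf (q r) - w r * p' r * q' r) N"
    proof (rule ord_ge_sum)
      fix r assume r: "r \<in> {..<N}"
      have p': "ord_ge (p' r) 0" unfolding p'_def by (rule ord_ge_sum) (auto intro: ord_ge_mono[OF p])
      have dp: "ord_ge (suminf (p r) - p' r) (N - r)"
        unfolding p'_def by (rule ord_ge_suminf_tail[OF p])
      have dq: "ord_ge (suminf (q r) - q' r) (N - r)"
        unfolding q'_def by (rule ord_ge_suminf_tail[OF q])
      have "ord_ge (w r * (suminf (p r) - p' r) * suminf (q r) + w r * p' r * (suminf (q r) - q' r)) N"
        using ord_ge_mult[OF ord_ge_mult[OF w dp] Q, of r r] ord_ge_mult[OF ord_ge_mult[OF w p'] dq, of r]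
        by (intro ord_ge_add) (auto elim: ord_ge_mono)
      thus "ord_ge (w r * suminf (p r) * suminf (q r) - w r * p' r * q' r) N"
        by (simp add: algebra_simps)
    qed
    have shift: "(\<Sum>i<N - r. g i) = (\<Sum>l=r..<N. g (l - r))" for r and g :: "nat \<Rightarrow> complex fls"
      by (rule sum.reindex_bij_witness[of _ "\<lambda>l. l - r" "\<lambda>i. i + r"]) auto
    have "(\<Sum>r<N. w r * p' r * q' r) = (\<Sum>r<N. \<Sum>l\<in>{r..<N}. \<Sum>m\<in>{r..<N}. w r * p r (l - r) * q r (m - r))"
      unfolding p'_def q'_def shift by (simp add: sum_distrib_left sum_distrib_right mult_ac)
    also have "\<dots> = (\<Sum>(r,l,m)\<in>(SIGMA r:{..<N}. {r..<N} \<times> {r..<N}). w r * p r (l - r) * q r (m - r))"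
      by (simp add: sum.Sigma sum.cartesian_product)
    also have "\<dots> = (\<Sum>((l,m),r)\<in>(SIGMA z:{..<N} \<times> {..<N}. {..min (fst z) (snd z)}). w r * p r (l - r) * q r (m - r))"
      by (rule sum.reindex_bij_witness[of _ "\<lambda>((l,m),r). (r,l,m)" "\<lambda>(r,l,m). ((l,m),r)"]) auto
    also have "\<dots> = (\<Sum>(l,m)\<in>{..<N} \<times> {..<N}. T l m)"
      unfolding T_def case_prod_beta by (subst sum.Sigma) (auto simp: case_prod_beta)
    finally have 2: "(\<Sum>r<N. w r * p' r * q' r) = (\<Sum>(l,m)\<in>{..<N} \<times> {..<N}. T l m)" .
    have "(\<Sum>n<N. \<Sum>l\<le>n. T l (n - l)) = (\<Sum>(n,l)\<in>(SIGMA n:{..<N}. {..n}). T l (n - l))"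
      by (simp add: sum.Sigma)
    also have "\<dots> = (\<Sum>(l,m)\<in>{z\<in>{..<N} \<times> {..<N}. fst z + snd z < N}. T l m)"
      by (rule sum.reindex_bij_witness[of _ "\<lambda>(l,m). (l + m, l)" "\<lambda>(n,l). (l, n - l)"]) auto
    finally have 3: "(\<Sum>n<N. \<Sum>l\<le>n. T l (n - l)) = (\<Sum>(l,m)\<in>{z\<in>{..<N} \<times> {..<N}. fst z + snd z < N}. T l m)" .
    \<comment> \<open>The corner \<open>l + m \<ge> N\<close> of the square contributes \<open>O(v\<^sup>N)\<close> only.\<close>
    have "(\<Sum>(l,m)\<in>{..<N} \<times> {..<N}. T l m) - (\<Sum>n<N. \<Sum>l\<le>n. T l (n - l))
        = (\<Sum>(l,m)\<in>{..<N} \<times> {..<N} - {z\<in>{..<N} \<times> {..<N}. fst z + snd z < N}. T l m)"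
      unfolding 3 by (subst sum_diff) auto
    also have "ord_ge \<dots> N"
      by (rule ord_ge_sum) (auto intro: ord_ge_mono[OF T])
    finally have 4: "ord_ge ((\<Sum>r<N. w r * p' r * q' r) - (\<Sum>n<N. \<Sum>l\<le>n. T l (n - l))) N"
      unfolding 2 .
    have 5: "ord_ge (S - (\<Sum>n<N. \<Sum>l\<le>n. T l (n - l))) N"
      unfolding S_def by (rule ord_ge_suminf_tail[OF Tn])
    show ?thesis
      using ord_ge_diff[OF ord_ge_add[OF 1 4] 5] by (simp add: sum_subtractf)
  qed
  thus ?thesis
    unfolding S_def[symmetric] by (subst sums_fls_iff[OF layer]) blast
qed

section \<open>The Burchnall--Chaundy expansion\<close>

lemma fact_conv_fls_const: "(fact n :: 'a::field_char_0 fls) = fls_const (fact n)"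
  by (metis fls_of_nat of_nat_fact)

lemma fls_const_sum: "fls_const (sum f A) = (\<Sum>i\<in>A. fls_const (f i))"
  by (induction A rule: infinite_finite_induct) (simp_all flip: fls_plus_const)

lemma fls_const_minus_one_power: "fls_const ((-1) ^ n * c) = (-1) ^ n * fls_const (c :: 'a::comm_ring_1)"
  by (cases "even n") simp_all

lemma ord_ge_const_divide:
  fixes g :: "'a::field fls"
  assumes "g \<noteq> 0" "fls_subdegree g = - int n"
  shows "ord_ge (fls_const c / g) n"
  using assms by (cases "c = 0") (simp_all add: ord_ge_subdegree fls_divide_subdegree)

text \<open>
  A series \<open>s\<close> of subdegree \<open>-1\<close> behaves like a nonzero multiple of \<open>Z\<close>: adding a number changes
  neither its order nor its invertibility, so each factor of a Pochhammer symbol lowers the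
  order by one.
\<close>

lemma subdegree_pochhammer:
  fixes s :: "'a::field_char_0 fls"
  assumes s: "fls_subdegree s = -1"
  shows "fls_subdegree (pochhammer (s + of_nat k) n) = - int n" "pochhammer (s + of_nat k) n \<noteq> 0"
proof -
  have sd: "fls_subdegree (s + of_nat j) = -1" for j
  proof (rule fls_subdegree_eqI)
    have "s \<noteq> 0" using s by auto
    hence "fls_nth s (-1) \<noteq> 0" using nth_fls_subdegree_nonzero[of s] s by simp
    thus "fls_nth (s + of_nat j) (-1) \<noteq> 0" by (simp add: fls_of_nat)
    show "fls_nth (s + of_nat j) k = 0" if "k < -1" for k
      using that s by (simp add: fls_of_nat)
  qed
  have nz: "s + of_nat j \<noteq> 0" for j
    using sd[of j] by auto
  have eq: "pochhammer (s + of_nat k) n = (\<Prod>i=0..<n. s + of_nat (k + i))"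
    by (simp add: pochhammer_prod add.assoc)
  show "pochhammer (s + of_nat k) n \<noteq> 0"
    unfolding eq using nz by (simp del: of_nat_add)
  show "fls_subdegree (pochhammer (s + of_nat k) n) = - int n"
    unfolding eq using nz sd by (simp add: fls_subdegree_prod del: of_nat_add)
qed

lemma ord_ge_F3_weight:
  fixes s :: "'a::field_char_0 fls"
  assumes s: "fls_subdegree s = -1"
  shows "ord_ge ((-1) ^ r * fls_const c
          / (fact r * pochhammer (s + 1) (2 * r) * pochhammer (s + of_nat r) r)) (3 * r)"
proof -
  have "(-1) ^ r * fls_const c = fls_const ((-1) ^ r * c)"
    by (rule fls_const_minus_one_power[symmetric])
  moreover have "fls_subdegree (fact r * pochhammer (s + 1) (2 * r) * pochhammer (s + of_nat r) r) = - int (3 * r)"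
    using subdegree_pochhammer[OF s, of 1 "2*r"] subdegree_pochhammer[OF s, of r r] by (simp add: fact_conv_fls_const)
  ultimately show ?thesis
    using subdegree_pochhammer(2)[OF s, of 1 "2*r"] subdegree_pochhammer(2)[OF s, of r r]
    by (simp only: ord_ge_const_divide mult_eq_0_iff fact_nonzero of_nat_1 simp_thms)
qed

lemma ord_ge_gauss_term:
  fixes s :: "'a::field_char_0 fls"
  assumes s: "fls_subdegree s = -1"
  shows "ord_ge (fls_const c / (pochhammer (s + 1 + 2 * of_nat r) k * fact k) * fls_const x ^ k) k"
proof -
  have eq: "s + 1 + 2 * of_nat r = s + of_nat (1 + 2 * r)" by simp
  have "ord_ge (fls_const c / (pochhammer (s + 1 + 2 * of_nat r) k * fact k)) k"
    unfolding eq using subdegree_pochhammer[OF s, of "1 + 2 * r" k]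
    by (intro ord_ge_const_divide) (simp_all add: fact_conv_fls_const del: of_nat_add)
  moreover have "ord_ge (fls_const x ^ k) 0"
    by (simp add: ord_ge_subdegree flip: fls_const_power)
  ultimately show ?thesis by (rule ord_ge_mult_integral)
qed

lemma ord_ge_gauss:
  assumes s: "fls_subdegree s = -1"
  shows "ord_ge (gauss_2F1 a b (s + 1 + 2 * of_nat r) x) 0"
  unfolding gauss_2F1_def by (intro ord_ge_suminf ord_ge_gauss_term s)

text \<open>
  The Burchnall--Chaundy expansion of the third Appell function
  \<open>F\<^sub>3(a, a', b, b'; c; x, y)\<close> into products of Gauss series, for a lower parameter \<open>c = s + 1\<close> that
  is large in the \<open>v\<close>-adic sense, so that the denominators make all the series converge, for
  whatever \<open>x\<close> and \<open>y\<close>.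
\<close>

theorem Burchnall_Chaundy_F3:
  fixes a b a' b' x y :: complex and s :: "complex fls"
  assumes s: "fls_subdegree s = -1"
  shows "(\<lambda>r. (-1) ^ r * fls_const (pochhammer a r * pochhammer b r * pochhammer a' r * pochhammer b' r * (x * y) ^ r)
            / (fact r * pochhammer (s + 1) (2 * r) * pochhammer (s + of_nat r) r)
            * gauss_2F1 (a + of_nat r) (b + of_nat r) (s + 1 + 2 * of_nat r) x
            * gauss_2F1 (a' + of_nat r) (b' + of_nat r) (s + 1 + 2 * of_nat r) y)
    sums (\<Sum>n. \<Sum>l\<le>n. fls_const (pochhammer a l * pochhammer b l * x ^ l
                 * (pochhammer a' (n - l) * pochhammer b' (n - l) * y ^ (n - l)))
            / (fact l * fact (n - l) * pochhammer (s + 1) n))"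
proof -
  define d where "d r = s + 1 + 2 * of_nat r" for r
  define w where "w r = (-1) ^ r * fls_const (pochhammer a r * pochhammer b r * pochhammer a' r * pochhammer b' r * (x * y) ^ r)
      / (fact r * pochhammer (s + 1) (2 * r) * pochhammer (s + of_nat r) r)" for r
  define p where "p r i = fls_const (pochhammer (a + of_nat r) i * pochhammer (b + of_nat r) i)
      / (pochhammer (d r) i * fact i) * fls_const x ^ i" for r i
  define q where "q r j = fls_const (pochhammer (a' + of_nat r) j * pochhammer (b' + of_nat r) j)
      / (pochhammer (d r) j * fact j) * fls_const y ^ j" for r j
  have w: "ord_ge (w r) (2 * r)" for r
    unfolding w_def by (rule ord_ge_mono[OF ord_ge_F3_weight[OF s]]) simp
  have p: "ord_ge (p r i) i" and q: "ord_ge (q r i) i" for r i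
    unfolding p_def q_def d_def by (intro ord_ge_gauss_term s)+
  have T: "(\<Sum>r\<le>min l m. w r * p r (l - r) * q r (m - r)) =
      fls_const (pochhammer a l * pochhammer b l * x ^ l * (pochhammer a' m * pochhammer b' m * y ^ m))
        / (fact l * fact m * pochhammer (s + 1) (l + m))" (is "_ = fls_const ?c / _") for l m
  proof -
    have "w r * p r (l - r) * q r (m - r) = fls_const ?c *
        ((-1) ^ r / (fact r * pochhammer (s + 1) (2 * r) * pochhammer (s + of_nat r) r)
           * (1 / (fact (l - r) * pochhammer (d r) (l - r)))
           * (1 / (fact (m - r) * pochhammer (d r) (m - r))))" if "r \<in> {..min l m}" for r
    proof -
      have r: "r \<le> l" "r \<le> m" using that by auto
      have "x ^ l = x ^ r * x ^ (l - r)" "y ^ m = y ^ r * y ^ (m - r)"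
        using r by (simp_all flip: power_add)
      hence "?c = (pochhammer a r * pochhammer b r * pochhammer a' r * pochhammer b' r * (x * y) ^ r)
          * (pochhammer (a + of_nat r) (l - r) * pochhammer (b + of_nat r) (l - r) * x ^ (l - r))
          * (pochhammer (a' + of_nat r) (m - r) * pochhammer (b' + of_nat r) (m - r) * y ^ (m - r))"
        unfolding pochhammer_product[OF r(1)] pochhammer_product[OF r(2)]
        by (simp only: power_mult_distrib mult_ac)
      thus ?thesis
        unfolding w_def p_def q_def
        by (simp only: fls_const_mult_const[symmetric] fls_const_power divide_inverse inverse_mult_distrib mult_1_left mult_ac)
    qed
    hence "(\<Sum>r\<le>min l m. w r * p r (l - r) * q r (m - r)) =
       fls_const ?c * (\<Sum>r\<le>min l m. (-1) ^ r / (fact r * pochhammer (s + 1) (2 * r) * pochhammer (s + of_nat r) r)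
           * (1 / (fact (l - r) * pochhammer (d r) (l - r)))
           * (1 / (fact (m - r) * pochhammer (d r) (m - r))))"
      unfolding sum_distrib_left by (intro sum.cong refl)
    also have "\<dots> = fls_const ?c * (1 / (fact l * fact m * pochhammer (s + 1) (l + m)))"
      unfolding d_def using subdegree_pochhammer(2)[OF s, of _ 1] by (subst F3_coefficient_identity) simp_all
    finally show ?thesis by simp
  qed
  have "(\<lambda>r. w r * suminf (p r) * suminf (q r))
      sums (\<Sum>n. \<Sum>l\<le>n. \<Sum>r\<le>min l (n - l). w r * p r (l - r) * q r (n - l - r))"
    by (rule sums_multiplied_out[OF w p q])
  also have "(\<Sum>n. \<Sum>l\<le>n. \<Sum>r\<le>min l (n - l). w r * p r (l - r) * q r (n - l - r)) =
    (\<Sum>n. \<Sum>l\<le>n. fls_const (pochhammer a l * pochhammer b l * x ^ l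
                 * (pochhammer a' (n - l) * pochhammer b' (n - l) * y ^ (n - l)))
            / (fact l * fact (n - l) * pochhammer (s + 1) n))"
    by (intro suminf_cong sum.cong refl) (simp only: T, simp)
  finally show ?thesis
    unfolding w_def p_def q_def d_def gauss_2F1_def .
qed

section \<open>The series \<open>F(\<alpha>, \<beta>; Z)\<close> as an Appell function\<close>

lemma gamma_pochhammer: "\<gamma> r (\<alpha>\<^sup>2) = pochhammer (1/2 - \<alpha>) r * pochhammer (1/2 + \<alpha>) r"
  unfolding \<gamma>_def pochhammer_prod atLeast0LessThan prod.distrib[symmetric]
  by (intro prod.cong refl) (simp add: power2_eq_square algebra_simps)

lemma x0_y0: "x0 * y0 = 1 / 2"
  by (simp add: x0_def y0_def complex_eq_iff)

text \<open>
  As \<open>p = 2x\<^sub>0\<close> and \<open>q = 2y\<^sub>0\<close>, the denominators \<open>(-2)\<^sup>k\<close> turn \<open>p\<close> and \<open>q\<close> into the arguments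
  \<open>-x\<^sub>0\<close> and \<open>-y\<^sub>0\<close>. The remaining sign \<open>(-1)\<^sup>n\<close> is the one that relates
  \<open>(Z - 1)\<cdots>(Z - n)\<close> to \<open>(1 - Z)\<^sub>n\<close>.
\<close>

lemma a_coeff_p: "a_coeff \<alpha> l * p_val ^ l = (-1) ^ l * (pochhammer (1/2 - \<alpha>) l * pochhammer (1/2 + \<alpha>) l * x0 ^ l) / fact l"
proof -
  have "p_val = (-2) * (- x0)" by (simp add: p_val_def x0_def field_simps)
  hence "p_val ^ l = (-2) ^ l * ((-1) ^ l * x0 ^ l)" by (metis power_mult_distrib mult_minus1)
  thus ?thesis by (simp add: a_coeff_def)
qed

lemma a_coeff_q: "a_coeff \<alpha> l * q_val ^ l = (-1) ^ l * (pochhammer (1/2 - \<alpha>) l * pochhammer (1/2 + \<alpha>) l * y0 ^ l) / fact l"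
proof -
  have "q_val = (-2) * (- y0)" by (simp add: q_val_def x0_def y0_def field_simps)
  hence "q_val ^ l = (-2) ^ l * ((-1) ^ l * y0 ^ l)" by (metis power_mult_distrib mult_minus1)
  thus ?thesis by (simp add: a_coeff_def)
qed

lemma pochhammer_1_minus_Z: "pochhammer (1 - Z) n = (\<Prod>j=1..n. of_nat j - Z)"
proof -
  have "(\<Prod>j=1..n. of_nat j - Z) = (\<Prod>i=0..<n. of_nat (Suc i) - Z)"
    by (rule prod.reindex_bij_witness[of _ Suc "\<lambda>j. j - 1"]) auto
  thus ?thesis by (simp add: pochhammer_prod algebra_simps)
qed

lemma F_series_as_F3:
  "F_series \<alpha> \<beta> = (\<Sum>n. \<Sum>l\<le>n.
      fls_const (pochhammer (1/2 - \<alpha>) l * pochhammer (1/2 + \<alpha>) l * x0 ^ l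
               * (pochhammer (1/2 - \<beta>) (n - l) * pochhammer (1/2 + \<beta>) (n - l) * y0 ^ (n - l)))
      / (fact l * fact (n - l) * pochhammer (1 - Z) n))"
  unfolding F_series_def
proof (intro suminf_cong)
  fix n
  define c where "c l = pochhammer (1/2 - \<alpha>) l * pochhammer (1/2 + \<alpha>) l * x0 ^ l
               * (pochhammer (1/2 - \<beta>) (n - l) * pochhammer (1/2 + \<beta>) (n - l) * y0 ^ (n - l))" for l
  have G: "G_coeff \<alpha> \<beta> n = (\<Sum>l\<le>n. (-1) ^ n * (c l / (fact l * fact (n - l))))"
    unfolding G_coeff_def atLeast0AtMost
  proof (intro sum.cong refl)
    fix l assume "l \<in> {..n}"
    hence s: "(-1) ^ n = (-1) ^ l * ((-1) ^ (n - l) :: complex)" by (simp flip: power_add)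
    have "a_coeff \<alpha> l * a_coeff \<beta> (n - l) * p_val ^ l * q_val ^ (n - l)
        = (a_coeff \<alpha> l * p_val ^ l) * (a_coeff \<beta> (n - l) * q_val ^ (n - l))"
      by (simp only: mult_ac)
    also have "\<dots> = (-1) ^ n * (c l / (fact l * fact (n - l)))"
      unfolding a_coeff_p a_coeff_q s c_def by simp
    finally show "a_coeff \<alpha> l * a_coeff \<beta> (n - l) * p_val ^ l * q_val ^ (n - l)
        = (-1) ^ n * (c l / (fact l * fact (n - l)))" .
  qed
  have "pochhammer (1 - Z) n = (\<Prod>j=1..n. (-1) * (Z - of_nat j))"
    by (simp add: pochhammer_1_minus_Z)
  also have "\<dots> = (-1) ^ n * (\<Prod>j=1..n. Z - of_nat j)"
    by (subst prod.distrib) simp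
  finally have "(\<Prod>j=1..n. Z - of_nat j) = (-1) ^ n * pochhammer (1 - Z) n"
    by (simp flip: mult.assoc power_mult_distrib)
  moreover have "fls_const (G_coeff \<alpha> \<beta> n) = (-1) ^ n * (\<Sum>l\<le>n. fls_const (c l) / (fact l * fact (n - l)))"
    unfolding G fls_const_sum fls_const_minus_one_power sum_distrib_left
    by (simp add: fact_conv_fls_const fls_const_divide_const)
  ultimately show "fls_const (G_coeff \<alpha> \<beta> n) / (\<Prod>j=1..n. Z - of_nat j) =
      (\<Sum>l\<le>n. fls_const (c l) / (fact l * fact (n - l) * pochhammer (1 - Z) n))"
    by (simp add: sum_divide_distrib)
qed

theorem corollary8p2:
  fixes \<alpha> \<beta> A B :: complex
  assumes "A = \<alpha>\<^sup>2" and "B = \<beta>\<^sup>2"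
  shows
    "let v = 1 / Z;
         layer = (\<lambda>r.
        (-1) ^ r * fls_const (\<gamma> r A) * fls_const (\<gamma> r B)
          / (2 ^ r * fact r * pochhammer (1 - Z) (2 * r) * pochhammer (- Z + of_nat r) r)
          * \<P> r \<alpha> * \<P>bar r \<beta>)
     in layer sums F_series \<alpha> \<beta>
      \<and> (\<forall>r. \<gamma> r A = pochhammer (1/2 - \<alpha>) r * pochhammer (1/2 + \<alpha>) r)
      \<and> (\<forall>r. \<gamma> r B = pochhammer (1/2 - \<beta>) r * pochhammer (1/2 + \<beta>) r)
      \<and> (\<forall>r. \<forall>n < 3 * int r. fls_nth (layer r) n = 0)
      \<and> (\<forall>r. (-1) ^ r * fls_const (x0 * y0) ^ r
              / (fact r * pochhammer (1 - Z) (2 * r) * pochhammer (- Z + of_nat r) r)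
            = v ^ (3 * r) / (2 ^ r * fact r)
              * (\<Prod>j=1..2*r. 1 / (1 - of_nat j * v))
              * (\<Prod>j=r..<2*r. 1 / (1 - of_nat j * v)))"
proof -
  define v where "v = 1 / Z"
  define layer where "layer = (\<lambda>r.
        (-1) ^ r * fls_const (\<gamma> r A) * fls_const (\<gamma> r B)
          / (2 ^ r * fact r * pochhammer (1 - Z) (2 * r) * pochhammer (- Z + of_nat r) r)
          * \<P> r \<alpha> * \<P>bar r \<beta>)"
  have sZ: "fls_subdegree (- Z) = -1" and Z: "Z \<noteq> 0"
    by (simp_all add: Z_def)
  have eqs: "- Z + 1 = 1 - Z" "- Z + 1 + 2 * of_nat r = 1 - Z + 2 * of_nat r" for r
    by simp_all
  have half: "fls_const (x0 * y0) ^ r = 1 / 2 ^ r" for r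
    by (simp add: x0_y0 power_one_over flip: fls_const_divide_const)
  define c where "c r = pochhammer (1/2 - \<alpha>) r * pochhammer (1/2 + \<alpha>) r
      * pochhammer (1/2 - \<beta>) r * pochhammer (1/2 + \<beta>) r * (x0 * y0) ^ r" for r
  have layer: "layer r = (-1) ^ r * fls_const (c r)
          / (fact r * pochhammer (1 - Z) (2 * r) * pochhammer (- Z + of_nat r) r)
          * \<P> r \<alpha> * \<P>bar r \<beta>" for r
  proof -
    have "fls_const (c r) = fls_const (\<gamma> r A) * fls_const (\<gamma> r B) * fls_const (x0 * y0) ^ r"
      unfolding c_def assms gamma_pochhammer by (simp add: mult.assoc flip: fls_const_power)
    thus ?thesis unfolding layer_def half
      by (simp only: divide_inverse inverse_mult_distrib mult_1_left mult_ac)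
  qed
  have "layer sums F_series \<alpha> \<beta>"
    using Burchnall_Chaundy_F3[OF sZ, of "1/2 - \<alpha>" "1/2 + \<alpha>" "1/2 - \<beta>" "1/2 + \<beta>" x0 y0]
    unfolding eqs F_series_as_F3 layer[abs_def] c_def \<P>_def \<P>bar_def .
  moreover have "ord_ge (layer r) (3 * r)" for r
  proof -
    have "ord_ge (\<P> r \<alpha>) 0" "ord_ge (\<P>bar r \<beta>) 0"
      using ord_ge_gauss[OF sZ] unfolding eqs \<P>_def \<P>bar_def by blast+
    with ord_ge_F3_weight[OF sZ, of r "c r"] show ?thesis
      unfolding layer eqs by (intro ord_ge_mult_integral)
  qed
  hence "\<forall>r. \<forall>n < 3 * int r. fls_nth (layer r) n = 0"
    by (simp add: ord_ge_def)
  moreover have "(-1) ^ r * fls_const (x0 * y0) ^ r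
              / (fact r * pochhammer (1 - Z) (2 * r) * pochhammer (- Z + of_nat r) r)
            = v ^ (3 * r) / (2 ^ r * fact r)
              * (\<Prod>j=1..2*r. 1 / (1 - of_nat j * v))
              * (\<Prod>j=r..<2*r. 1 / (1 - of_nat j * v))" for r
  proof -
    \<comment> \<open>Each of the \<open>3r\<close> factors of the two Pochhammer symbols is \<open>-Z (1 - jv)\<close>.\<close>
    have j: "of_nat j - Z = - Z * (1 - of_nat j * v)" for j
      using Z by (simp add: v_def algebra_simps)
    have 1: "pochhammer (1 - Z) (2 * r) = (- Z) ^ (2 * r) * (\<Prod>j=1..2*r. 1 - of_nat j * v)"
      unfolding pochhammer_1_minus_Z j by (simp only: prod.distrib prod_constant card_atLeastAtMost) simp
    have "pochhammer (- Z + of_nat r) r = (\<Prod>j=r..<2*r. of_nat j - Z)"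
      unfolding pochhammer_prod
      by (rule prod.reindex_bij_witness[of _ "\<lambda>j. j - r" "\<lambda>j. j + r"]) auto
    hence 2: "pochhammer (- Z + of_nat r) r = (- Z) ^ r * (\<Prod>j=r..<2*r. 1 - of_nat j * v)"
      unfolding j by (simp only: prod.distrib prod_constant card_atLeastLessThan) simp
    have v_power: "v ^ (3 * r) = 1 / Z ^ (3 * r)"
      by (simp add: v_def power_one_over)
    have 3: "(- Z) ^ (2 * r) * (- Z) ^ r = (-1) ^ r * Z ^ (3 * r)"
    proof -
      have "(- Z) ^ (2 * r) * (- Z) ^ r = (-1) ^ r * (Z ^ (2 * r) * Z ^ r)"
        by (simp add: power_minus[of Z r])
      thus ?thesis by (simp flip: power_add)
    qed
    have "(-1) ^ r * fls_const (x0 * y0) ^ r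
              / (fact r * pochhammer (1 - Z) (2 * r) * pochhammer (- Z + of_nat r) r)
        = (-1) ^ r / ((- Z) ^ (2 * r) * (- Z) ^ r)
          * (1 / (2 ^ r * fact r * (\<Prod>j=1..2*r. 1 - of_nat j * v) * (\<Prod>j=r..<2*r. 1 - of_nat j * v)))"
      unfolding 1 2 half
      by (simp only: divide_inverse inverse_mult_distrib mult_1_left mult_ac)
    also have "(-1) ^ r / ((- Z) ^ (2 * r) * (- Z) ^ r) = v ^ (3 * r)"
      unfolding 3 v_power by simp
    finally show ?thesis
      unfolding prod_dividef prod.neutral_const by simp
  qed
  ultimately show ?thesis
    unfolding Let_def layer_def[symmetric] v_def[symmetric]
    using gamma_pochhammer assms by blast
qed

end
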